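(* Let $m>2$ be an integer, and let $\mathfrak{A}$ be the set of all algorithms $A$ such that, for the schedule $\sigma^A$ constructed by $A$, one has $J(\sigma_2)\subseteq J(\sigma^A)$. Then for each $A\in\mathfrak{A}$, $$F(\sigma^* )\le \frac{m}{2}\,F(\sigma^A)$$ for every instance with $m$ machines, and this performance guarantee is tight: for each $A\in\mathfrak{A}$ and each $\varepsilon>0$ there exists an instance with $m$ machines for which $$F(\sigma^* )>\left(\frac{m}{2}-\varepsilon\right)F(\sigma^A).$$ Here $F$, $J(\cdot)$, $\sigma^*$, $\sigma_2$, $\sigma^A$ and the notion of instance are as defined in the context.
   Context: An instance consists of a set $N=\{1,\dots,n\}$ of jobs, a number $m$ of identical parallel machines, a weight $w_j>0$ for each job $j\in N$, a common deadline $D$ (a positive integer), and an undirected conflict graph $G(N,E)$ whose edges are the pairs of jobs that cannot be processed concurrently. All jobs have processing time $p_j=1$ (unit execution time jobs). A (feasible) schedule $\sigma$ specifies for each $j\in N$ a starting time $S_j(\sigma)\ge 0$; job $j$ is processed without interruption by a single machine during $[S_j(\sigma),C_j(\sigma)]$, where $C_j(\sigma)=S_j(\sigma)+1$. Each machine processes at most one job at any point in time (except that one job may finish at the same instant at which another starts), so at most $m$ jobs are processed concurrently. Two jobs joined by an edge of $E$ are never processed concurrently, i.e. the interiors of their processing intervals are disjoint. Standing assumption: the minimum of the makespan $C_{\max}(\sigma)=\max_{j\in N}C_j(\sigma)$ over all feasible schedules on $m$ machines is greater than $D$. For a schedule $\sigma$, $J(\sigma)=\{j\in N: C_j(\sigma)\le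 D\}$ is the set of jobs completed on time, and $F(\sigma)=\sum_{j\in J(\sigma)}w_j$ is the total weight of on-time jobs. For a given instance: - $\sigma^*$ is an optimal schedule, i.e. a feasible schedule on $m$ machines with the largest value of $F$; - $\sigma_2$ is a schedule with the largest value of $F$ for the problem obtained from the instance by replacing the number of machines $m$ by $2$ (all other data unchanged); - for an algorithm $A$, $\sigma^A$ is the (feasible, $m$-machine) schedule constructed by $A$. The condition $J(\sigma_2)\subseteq J(\sigma^A)$ defining $\mathfrak{A}$ is required to hold on every instance. *)

theory Defs
  imports Complex_Main
begin

text \<open>
  Scheduling of unit execution time jobs with a conflict graph on identical parallel machines.
  The jobs are \<open>1, \<dots>, num_jobs\<close>; an edge of the conflict graph is a two-element set of jobs.
  The values of \<open>weight\<close> outside the set of jobs are irrelevant.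
\<close>

record uet_problem =
  num_jobs :: nat
  machines :: nat
  weight :: "nat \<Rightarrow> real"
  deadline :: nat
  conflicts :: "nat set set"

definition jobs :: "uet_problem \<Rightarrow> nat set" where
  "jobs I = {1..num_jobs I}"

text \<open>A schedule assigns to each job its starting time.\<close>

type_synonym schedule = "nat \<Rightarrow> real"

definition completion :: "schedule \<Rightarrow> nat \<Rightarrow> real" where
  "completion \<sigma> j = \<sigma> j + 1"

definition concurrent :: "schedule \<Rightarrow> nat \<Rightarrow> nat \<Rightarrow> bool" where
  "concurrent \<sigma> i j \<longleftrightarrow> {\<sigma> i<..<completion \<sigma> i} \<inter> {\<sigma> j<..<completion \<sigma> j} \<noteq> {}"

text \<open>The function \<open>\<mu>\<close> below names the machine that processes each job.\<close>

definition feasible :: "uet_problem \<Rightarrow> schedule \<Rightarrow> bool" where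
  "feasible I \<sigma> \<longleftrightarrow>
     (\<forall>j\<in>jobs I. 0 \<le> \<sigma> j) \<and>
     (\<exists>\<mu> :: nat \<Rightarrow> nat.
        (\<forall>j\<in>jobs I. \<mu> j \<in> {1..machines I}) \<and>
        (\<forall>i\<in>jobs I. \<forall>j\<in>jobs I. i \<noteq> j \<and> \<mu> i = \<mu> j \<longrightarrow> \<not> concurrent \<sigma> i j)) \<and>
     (\<forall>i\<in>jobs I. \<forall>j\<in>jobs I. {i, j} \<in> conflicts I \<longrightarrow> \<not> concurrent \<sigma> i j)"

definition makespan :: "uet_problem \<Rightarrow> schedule \<Rightarrow> real" where
  "makespan I \<sigma> = Max (completion \<sigma> ` jobs I)"

text \<open>
  The last conjunct is the standing assumption that the minimum makespan exceeds the deadline.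
\<close>

definition valid_instance :: "uet_problem \<Rightarrow> bool" where
  "valid_instance I \<longleftrightarrow>
     1 \<le> num_jobs I \<and> 1 \<le> machines I \<and>
     (\<forall>j\<in>jobs I. 0 < weight I j) \<and>
     0 < deadline I \<and>
     conflicts I \<subseteq> {{i, j} | i j. i \<in> jobs I \<and> j \<in> jobs I \<and> i \<noteq> j} \<and>
     (\<forall>\<sigma>. feasible I \<sigma> \<longrightarrow> real (deadline I) < makespan I \<sigma>)"

definition on_time :: "uet_problem \<Rightarrow> schedule \<Rightarrow> nat set" where
  "on_time I \<sigma> = {j \<in> jobs I. completion \<sigma> j \<le> real (deadline I)}"

definition on_time_weight :: "uet_problem \<Rightarrow> schedule \<Rightarrow> real" where
  "on_time_weight I \<sigma> = (\<Sum>j\<in>on_time I \<sigma>. weight I j)"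

definition optimal :: "uet_problem \<Rightarrow> schedule \<Rightarrow> bool" where
  "optimal I \<sigma> \<longleftrightarrow> is_arg_max (on_time_weight I) (feasible I) \<sigma>"

text \<open>
  An algorithm for instances with \<open>m\<close> machines is identified with the function that maps each
  instance to the schedule constructed for it; computability is not required.
\<close>

definition is_algorithm :: "nat \<Rightarrow> (uet_problem \<Rightarrow> schedule) \<Rightarrow> bool" where
  "is_algorithm m A \<longleftrightarrow> (\<forall>I. valid_instance I \<and> machines I = m \<longrightarrow> feasible I (A I))"

text \<open>
  An optimal two-machine schedule need not be unique. Asking only that the on-time set of
  \<^emph>\<open>some\<close> such schedule be contained in that of the constructed one covers every possible choice
  of \<open>\<sigma>\<^sub>2\<close> and gives the largest class of algorithms.
\<close>

definition two_machine_class :: "nat \<Rightarrow> (uet_problem \<Rightarrow> schedule) set" where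
  "two_machine_class m = {A. is_algorithm m A \<and>
     (\<forall>I. valid_instance I \<and> machines I = m \<longrightarrow>
        (\<exists>\<sigma>\<^sub>2. optimal (I\<lparr>machines := 2\<rparr>) \<sigma>\<^sub>2 \<and> on_time I \<sigma>\<^sub>2 \<subseteq> on_time I (A I)))}"

end

theory Submission
  imports Defs
begin

text \<open>
  Upper bound: fix machine assignments of an optimal schedule. The two machines carrying the
  largest on-time weight carry at least the fraction \<open>2 / m\<close> of it, and postponing all
  other jobs beyond the deadline yields a two-machine schedule.

  Tightness: let \<open>D = 1\<close>, take \<open>m\<close> pairwise compatible jobs of weight \<open>1\<close> and two compatible
  jobs of weight \<open>1 + \<delta>\<close>, each in conflict with all the light ones. With two machines
  only the heavy pair is optimal, and no further job can be on time together with it.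
\<close>

section \<open>Overlap, on-time sets and the construction of schedules\<close>

lemma concurrent_iff: "concurrent \<sigma> i j \<longleftrightarrow> \<bar>\<sigma> i - \<sigma> j\<bar> < 1"
proof
  assume "concurrent \<sigma> i j"
  then show "\<bar>\<sigma> i - \<sigma> j\<bar> < 1"
    unfolding concurrent_def completion_def by auto
next
  assume "\<bar>\<sigma> i - \<sigma> j\<bar> < 1"
  \<comment> \<open>This is the midpoint between the later start and the earlier completion, hence
    the centre of the overlap.\<close>
  then have "(\<sigma> i + \<sigma> j + 1) / 2 \<in>
    {\<sigma> i<..<completion \<sigma> i} \<inter> {\<sigma> j<..<completion \<sigma> j}"
    unfolding completion_def by (auto simp: field_simps)
  then show "concurrent \<sigma> i j"
    unfolding concurrent_def by blast
qed

lemma finite_on_time: "finite (on_time I \<sigma>)"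
  unfolding on_time_def jobs_def by simp

lemma jobs_machines: "jobs (I\<lparr>machines := k\<rparr>) = jobs I"
  unfolding jobs_def by simp

lemma on_time_machines: "on_time (I\<lparr>machines := k\<rparr>) \<sigma> = on_time I \<sigma>"
  and on_time_weight_machines: "on_time_weight (I\<lparr>machines := k\<rparr>) \<sigma> = on_time_weight I \<sigma>"
  unfolding on_time_weight_def on_time_def jobs_def by simp_all

text \<open>Reduces the construction of a schedule to its on-time part \<open>P\<close>: all
  remaining jobs run one at a time after the deadline, where they can violate neither a machine nor
  a conflict constraint.\<close>

lemma feasible_extension:
  assumes P: "P \<subseteq> jobs I" and machines: "1 \<le> machines I"
    and loopfree: "\<And>j. {j, j} \<notin> conflicts I"
    and start: "\<And>j. j \<in> P \<Longrightarrow> 0 \<le> \<sigma> j \<and> completion \<sigma> j \<le> real (deadline I)"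
    and assign: "\<And>j. j \<in> P \<Longrightarrow> \<mu> j \<in> {1..machines I}"
    and machine: "\<And>i j. \<lbrakk>i \<in> P; j \<in> P; i \<noteq> j; \<mu> i = \<mu> j\<rbrakk> \<Longrightarrow> \<not> concurrent \<sigma> i j"
    and conflict: "\<And>i j. \<lbrakk>i \<in> P; j \<in> P; {i, j} \<in> conflicts I\<rbrakk> \<Longrightarrow> \<not> concurrent \<sigma> i j"
  shows "\<exists>\<sigma>'. feasible I \<sigma>' \<and> on_time I \<sigma>' = P"
proof -
  \<comment> \<open>Distinct job numbers keep the late starts at least one unit apart, so machine 1
    can take all late jobs. Each of them starts no earlier than the deadline, when every job of
    \<open>P\<close> is finished.\<close>
  define \<sigma>' where "\<sigma>' j = (if j \<in> P then \<sigma> j else real (deadline I) + real j)" for j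
  define \<mu>' where "\<mu>' j = (if j \<in> P then \<mu> j else 1)" for j
  \<comment> \<open>A late job overlaps no other job, so any clash in \<open>\<sigma>'\<close> is
    already a clash in \<open>\<sigma>\<close> within \<open>P\<close>.\<close>
  have overlap: "i \<in> P \<and> j \<in> P \<and> concurrent \<sigma> i j"
    if "concurrent \<sigma>' i j" "i \<noteq> j" for i j
  proof -
    have "real i - real j \<ge> 1 \<or> real j - real i \<ge> 1"
      using \<open>i \<noteq> j\<close> by linarith
    then show ?thesis
      using that(1) start[of i] start[of j]
      unfolding concurrent_iff \<sigma>'_def completion_def by (auto split: if_splits)
  qed
  have "feasible I \<sigma>'"
    unfolding feasible_def
  proof (intro conjI exI[of _ \<mu>'] ballI impI)
    fix j show "0 \<le> \<sigma>' j"
      using start[of j] by (simp add: \<sigma>'_def)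
    show "\<mu>' j \<in> {1..machines I}"
      using assign[of j] machines by (simp add: \<mu>'_def)
  next
    fix i j assume "i \<noteq> j \<and> \<mu>' i = \<mu>' j"
    then show "\<not> concurrent \<sigma>' i j"
      using overlap[of i j] machine[of i j] by (auto simp: \<mu>'_def)
  next
    fix i j assume "{i, j} \<in> conflicts I"
    moreover from this have "i \<noteq> j"
      using loopfree[of i] by auto
    ultimately show "\<not> concurrent \<sigma>' i j"
      using overlap[of i j] conflict[of i j] by blast
  qed
  moreover have "on_time I \<sigma>' = P"
    using P start by (auto simp: on_time_def \<sigma>'_def completion_def)
  ultimately show ?thesis by blast
qed

text \<open>A job is concurrent with itself and the conflict clause of \<open>feasible\<close> also
  covers \<open>i = j\<close>, so a singleton edge on a job would exclude every schedule. This
  supplies the corresponding hypothesis of \<open>feasible_extension\<close>.\<close>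

lemma valid_instance_loopfree:
  assumes "valid_instance I"
  shows "{j, j} \<notin> conflicts I"
proof
  assume "{j, j} \<in> conflicts I"
  then have "{j, j} \<in> {{i, j} | i j. i \<in> jobs I \<and> j \<in> jobs I \<and> i \<noteq> j}"
    using assms unfolding valid_instance_def by blast
  then show False by (auto simp: doubleton_eq_iff)
qed

section \<open>Upper bound by restriction to two machines\<close>

text \<open>Take \<open>a\<close> maximal in \<open>M\<close> and \<open>b\<close> maximal in the
  rest. The sum is then at most \<open>W a + (card M - 1) * W b\<close>, and shifting weight from
  \<open>W b\<close> to the larger \<open>W a\<close> balances the coefficients. The signs of the
  summands do not matter.\<close>

lemma two_largest_summands:
  fixes W :: "'a \<Rightarrow> real"
  assumes "finite M" "card M \<ge> 2"
  obtains a b where "a \<in> M" "b \<in> M" "a \<noteq> b" "sum W M \<le> real (card M) / 2 * (W a + W b)"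
proof -
  have ex_max: "\<exists>a\<in>S. \<forall>k\<in>S. W k \<le> W a" if "finite S" "S \<noteq> {}" for S
  proof -
    have "Max (W ` S) \<in> W ` S" using that by simp
    then obtain a where "a \<in> S" "W a = Max (W ` S)" by auto
    then show ?thesis using that by (auto intro!: bexI[of _ a])
  qed
  have "M \<noteq> {}" using assms by auto
  then obtain a where a: "a \<in> M" "\<And>k. k \<in> M \<Longrightarrow> W k \<le> W a"
    using ex_max[OF assms(1)] by auto
  have card: "card (M - {a}) = card M - 1" using a assms by simp
  have "M - {a} \<noteq> {}"
  proof
    assume "M - {a} = {}"
    then have "card (M - {a}) = 0" by (simp only: card.empty)
    then show False using card assms(2) by simp
  qed
  then obtain b where b: "b \<in> M - {a}" "\<And>k. k \<in> M - {a} \<Longrightarrow> W k \<le> W b"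
    using ex_max[of "M - {a}"] assms(1) by auto
  have "sum W (M - {a}) \<le> real (card (M - {a})) * W b"
    by (rule sum_bounded_above) (use b in auto)
  moreover have "sum W M = W a + sum W (M - {a})"
    by (rule sum.remove) (use a assms in auto)
  moreover have "real (card (M - {a})) = real (card M) - 1"
    using card assms by simp
  ultimately have "sum W M \<le> W a + (real (card M) - 1) * W b"
    by simp
  \<comment> \<open>Twice the difference between \<open>card M / 2 * (W a + W b)\<close> and the
    bound just obtained.\<close>
  moreover have "0 \<le> (real (card M) - 2) * (W a - W b)"
    using a(2)[of b] b(1) assms(2) by (intro mult_nonneg_nonneg) auto
  ultimately have "sum W M \<le> real (card M) / 2 * (W a + W b)"
    by (simp add: field_simps)
  then show thesis using that a b by auto
qed

text \<open>The on-time jobs are partitioned by their machine. Those of the two heaviest machines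
  keep their starting times, and \<open>feasible_extension\<close> postpones the others.\<close>

lemma two_machine_restriction:
  assumes valid: "valid_instance I" and feas: "feasible I \<sigma>" and m: "machines I \<ge> 2"
  obtains \<sigma>' where "feasible (I\<lparr>machines := 2\<rparr>) \<sigma>'"
    and "on_time_weight I \<sigma> \<le> real (machines I) / 2 * on_time_weight I \<sigma>'"
proof -
  let ?I = "I\<lparr>machines := 2\<rparr>"
  obtain \<mu> where \<mu>: "\<And>j. j \<in> jobs I \<Longrightarrow> \<mu> j \<in> {1..machines I}"
    "\<And>i j. \<lbrakk>i \<in> jobs I; j \<in> jobs I; i \<noteq> j; \<mu> i = \<mu> j\<rbrakk> \<Longrightarrow> \<not> concurrent \<sigma> i j"
    using feas unfolding feasible_def by blast
  have conflict: "\<not> concurrent \<sigma> i j"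
    if "i \<in> jobs I" "j \<in> jobs I" "{i, j} \<in> conflicts I" for i j
    using feas that unfolding feasible_def by blast
  define part where "part k = {j \<in> on_time I \<sigma>. \<mu> j = k}" for k
  define W where "W k = sum (weight I) (part k)" for k
  have sub: "on_time I \<sigma> \<subseteq> jobs I"
    by (auto simp: on_time_def)
  have total: "on_time_weight I \<sigma> = sum W {1..machines I}"
    unfolding on_time_weight_def W_def part_def
    by (rule sum.group[symmetric]) (use \<mu>(1) sub finite_on_time in auto)
  obtain a b where ab: "a \<noteq> b" "sum W {1..machines I} \<le> real (machines I) / 2 * (W a + W b)"
    by (rule two_largest_summands[of "{1..machines I}" W]) (use m in auto)
  have "\<exists>\<sigma>'. feasible ?I \<sigma>' \<and> on_time ?I \<sigma>' = part a \<union> part b"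
  \<comment> \<open>Machine \<open>a\<close> is renamed 1 and machine \<open>b\<close> is renamed 2.
    Equal new labels within the two parts mean equal old ones, so no new clash arises.\<close>
  proof (rule feasible_extension[where \<mu> = "\<lambda>j. if \<mu> j = a then 1 else 2"])
    show "part a \<union> part b \<subseteq> jobs ?I"
      using sub by (auto simp: part_def jobs_def)
    show "1 \<le> machines ?I" by simp
    show "{j, j} \<notin> conflicts ?I" for j
      using valid_instance_loopfree[OF valid] by simp
  next
    fix j assume "j \<in> part a \<union> part b"
    then show "0 \<le> \<sigma> j \<and> completion \<sigma> j \<le> real (deadline ?I)"
      using feas by (auto simp: part_def on_time_def feasible_def)
  next
    fix i j assume "i \<in> part a \<union> part b" "j \<in> part a \<union> part b" "i \<noteq> j"
      "(if \<mu> i = a then 1 else 2 :: nat) = (if \<mu> j = a then 1 else 2)"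
    then show "\<not> concurrent \<sigma> i j"
      using \<mu>(2)[of i j] sub by (auto simp: part_def split: if_splits)
  next
    fix i j assume "i \<in> part a \<union> part b" "j \<in> part a \<union> part b" "{i, j} \<in> conflicts ?I"
    then show "\<not> concurrent \<sigma> i j"
      using conflict sub by (auto simp: part_def)
  qed simp
  then obtain \<sigma>' where \<sigma>': "feasible ?I \<sigma>'" "on_time I \<sigma>' = part a \<union> part b"
    by (auto simp: on_time_machines)
  have "on_time_weight I \<sigma>' = W a + W b"
    unfolding on_time_weight_def \<sigma>'(2) W_def
    by (rule sum.union_disjoint) (use ab finite_on_time in \<open>auto simp: part_def\<close>)
  then show thesis using that \<sigma>'(1) ab(2) total by simp
qed

lemma on_time_weight_mono:
  assumes "valid_instance I" "on_time I \<sigma> \<subseteq> on_time I \<tau>"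
  shows "on_time_weight I \<sigma> \<le> on_time_weight I \<tau>"
  unfolding on_time_weight_def
proof (rule sum_mono2)
  fix j assume "j \<in> on_time I \<tau> - on_time I \<sigma>"
  then have "j \<in> jobs I" by (simp add: on_time_def)
  then show "0 \<le> weight I j"
    using assms(1) unfolding valid_instance_def by (simp add: less_imp_le)
qed (use assms finite_on_time in auto)

text \<open>The restriction of \<open>\<sigma>\<close> competes with \<open>\<sigma>2\<close> on two
  machines, and the on-time set of \<open>\<sigma>2\<close> lies inside that of
  \<open>A I\<close>.\<close>

lemma guarantee:
  assumes "m \<ge> 2" "A \<in> two_machine_class m" "valid_instance I" "machines I = m" "feasible I \<sigma>"
  shows "on_time_weight I \<sigma> \<le> real m / 2 * on_time_weight I (A I)"
proof -
  obtain \<sigma>2 where opt: "optimal (I\<lparr>machines := 2\<rparr>) \<sigma>2" and sub: "on_time I \<sigma>2 \<subseteq> on_time I (A I)"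
    using assms unfolding two_machine_class_def by blast
  obtain \<sigma>' where \<sigma>': "feasible (I\<lparr>machines := 2\<rparr>) \<sigma>'"
    "on_time_weight I \<sigma> \<le> real m / 2 * on_time_weight I \<sigma>'"
    using two_machine_restriction assms by metis
  have "on_time_weight I \<sigma>' \<le> on_time_weight I \<sigma>2"
    using opt \<sigma>'(1) unfolding optimal_def is_arg_max_linorder on_time_weight_machines by blast
  also have "\<dots> \<le> on_time_weight I (A I)"
    using on_time_weight_mono assms(3) sub .
  finally have "real m / 2 * on_time_weight I \<sigma>' \<le> real m / 2 * on_time_weight I (A I)"
    by (rule mult_left_mono) simp
  with \<sigma>'(2) show ?thesis by linarith
qed

section \<open>The extremal instances and tightness\<close>

text \<open>The conflict graph is complete bipartite. A positive \<open>\<delta>\<close> breaks the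
  tie between two light and two heavy jobs on two machines.\<close>

definition tight_instance :: "nat \<Rightarrow> real \<Rightarrow> uet_problem" where
  "tight_instance m \<delta> = \<lparr>num_jobs = m + 2, machines = m,
     weight = (\<lambda>j. if j \<le> m then 1 else 1 + \<delta>), deadline = 1,
     conflicts = {{i, j} | i j. i \<in> {1..m} \<and> j \<in> {m + 1, m + 2}}\<rparr>"

lemma tight_instance_simps:
  "jobs (tight_instance m \<delta>) = {1..m + 2}"
  "machines (tight_instance m \<delta>) = m"
  "weight (tight_instance m \<delta>) j = (if j \<le> m then 1 else 1 + \<delta>)"
  "deadline (tight_instance m \<delta>) = 1"
  "conflicts (tight_instance m \<delta>) = {{i, j} | i j. i \<in> {1..m} \<and> j \<in> {m + 1, m + 2}}"
  unfolding tight_instance_def jobs_def by simp_all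

lemma tight_instance_conflict_iff:
  "{i, j} \<in> conflicts (tight_instance m \<delta>) \<longleftrightarrow>
    i \<in> {1..m} \<and> j \<in> {m + 1, m + 2} \<or> j \<in> {1..m} \<and> i \<in> {m + 1, m + 2}"
  unfolding tight_instance_simps by (auto simp: doubleton_eq_iff)

text \<open>The parameter \<open>k\<close> covers both the \<open>m\<close>-machine and the two-machine version.\<close>

lemma tight_instance_on_time_start:
  assumes "feasible ((tight_instance m \<delta>)\<lparr>machines := k\<rparr>) \<sigma>" "j \<in> on_time (tight_instance m \<delta>) \<sigma>"
  shows "\<sigma> j = 0"
proof -
  \<comment> \<open>With deadline 1, a unit job is on time only if it starts no later than
    0.\<close>
  have "j \<in> jobs ((tight_instance m \<delta>)\<lparr>machines := k\<rparr>)" "\<sigma> j \<le> 0"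
    using assms(2) by (simp_all add: on_time_def jobs_def completion_def tight_instance_def)
  moreover from this(1) have "0 \<le> \<sigma> j"
    using assms(1) unfolding feasible_def by blast
  ultimately show ?thesis by simp
qed

text \<open>All on-time jobs start at 0 and hence run concurrently, so a light and a heavy one
  together would violate an edge.\<close>

lemma tight_instance_on_time_cases:
  assumes feas: "feasible ((tight_instance m \<delta>)\<lparr>machines := k\<rparr>) \<sigma>"
  shows "on_time (tight_instance m \<delta>) \<sigma> \<subseteq> {1..m} \<or> on_time (tight_instance m \<delta>) \<sigma> \<subseteq> {m + 1, m + 2}"
proof (rule ccontr)
  let ?I = "tight_instance m \<delta>"
  assume neg: "\<not> ?thesis"
  have "on_time ?I \<sigma> \<subseteq> {1..m + 2}"
    by (auto simp: on_time_def tight_instance_simps)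
  moreover have "{1..m + 2} = {1..m} \<union> {m + 1, m + 2}" by auto
  ultimately obtain i j where ij: "i \<in> on_time ?I \<sigma>" "j \<in> on_time ?I \<sigma>" "i \<in> {1..m}" "j \<in> {m + 1, m + 2}"
    using neg by blast
  then have "concurrent \<sigma> i j"
    using tight_instance_on_time_start[OF feas] by (simp add: concurrent_iff)
  moreover have "{i, j} \<in> conflicts ?I"
    using ij unfolding tight_instance_conflict_iff by blast
  moreover have "i \<in> jobs ?I" "j \<in> jobs ?I"
    using ij by (auto simp: on_time_def)
  ultimately show False
    using feas unfolding feasible_def by (simp add: jobs_def)
qed

text \<open>On-time jobs are pairwise concurrent, so the machine assignment is injective on
  them.\<close>

lemma tight_instance_card_on_time:
  assumes feas: "feasible ((tight_instance m \<delta>)\<lparr>machines := k\<rparr>) \<sigma>"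
  shows "card (on_time (tight_instance m \<delta>) \<sigma>) \<le> k"
proof -
  let ?I = "tight_instance m \<delta>"
  obtain \<mu> where \<mu>: "\<forall>j\<in>jobs ?I. \<mu> j \<in> {1..k}"
    "\<forall>i\<in>jobs ?I. \<forall>j\<in>jobs ?I. i \<noteq> j \<and> \<mu> i = \<mu> j \<longrightarrow> \<not> concurrent \<sigma> i j"
    using feas unfolding feasible_def jobs_machines by auto
  have sub: "on_time ?I \<sigma> \<subseteq> jobs ?I"
    by (auto simp: on_time_def)
  have "inj_on \<mu> (on_time ?I \<sigma>)"
  proof (rule inj_onI, rule ccontr)
    fix i j assume "i \<in> on_time ?I \<sigma>" "j \<in> on_time ?I \<sigma>" "\<mu> i = \<mu> j" "i \<noteq> j"
    moreover from this have "concurrent \<sigma> i j"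
      using tight_instance_on_time_start[OF feas] by (simp add: concurrent_iff)
    ultimately show False
      using \<mu>(2) sub by blast
  qed
  moreover have "\<mu> ` on_time ?I \<sigma> \<subseteq> {1..k}"
    using \<mu>(1) sub by blast
  ultimately show ?thesis
    using card_inj_on_le[of \<mu> _ "{1..k}"] by simp
qed

text \<open>Conversely, such a set \<open>P\<close> spans no edge, so all its jobs can start at 0 on
  distinct machines.\<close>

lemma tight_instance_feasible:
  assumes P: "P \<subseteq> {1..m} \<or> P \<subseteq> {m + 1, m + 2}" and "card P \<le> k" "1 \<le> k"
  shows "\<exists>\<sigma>. feasible ((tight_instance m \<delta>)\<lparr>machines := k\<rparr>) \<sigma> \<and> on_time (tight_instance m \<delta>) \<sigma> = P"
proof -
  let ?I = "(tight_instance m \<delta>)\<lparr>machines := k\<rparr>"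
  have "finite P"
    using P by (auto dest: finite_subset)
  then obtain \<mu> where \<mu>: "\<mu> ` P \<subseteq> {1..k}" "inj_on \<mu> P"
    using card_le_inj[of P "{1..k}"] assms(2) by auto
  have "\<exists>\<sigma>. feasible ?I \<sigma> \<and> on_time ?I \<sigma> = P"
  proof (rule feasible_extension[where \<sigma> = "\<lambda>_. 0" and \<mu> = \<mu>])
    show "P \<subseteq> jobs ?I"
      using P by (auto simp: jobs_def tight_instance_def)
    show "{j, j} \<notin> conflicts ?I" for j
      using tight_instance_conflict_iff[of j j m \<delta>] by auto
    show "0 \<le> (0::real) \<and> completion (\<lambda>_. 0) j \<le> real (deadline ?I)" for j
      by (simp add: completion_def tight_instance_simps)
  next
    fix i j assume "i \<in> P" "j \<in> P" "{i, j} \<in> conflicts ?I"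
    then have "{i, j} \<in> conflicts (tight_instance m \<delta>)" by simp
    then show "\<not> concurrent (\<lambda>_. 0) i j"
      using P \<open>i \<in> P\<close> \<open>j \<in> P\<close> unfolding tight_instance_conflict_iff by auto
  qed (use \<mu> assms(3) in \<open>auto dest: inj_onD\<close>)
  then show ?thesis by (simp add: on_time_machines)
qed

lemma tight_instance_valid:
  assumes "m \<ge> 1" "\<delta> > 0"
  shows "valid_instance (tight_instance m \<delta>)"
  unfolding valid_instance_def
proof (intro conjI allI impI)
  let ?I = "tight_instance m \<delta>"
  fix \<sigma> assume "feasible ?I \<sigma>"
  \<comment> \<open>The update leaves the instance unchanged; it only matches the form of the lemmas
    with parameter \<open>k\<close>.\<close>
  then have feas: "feasible (?I\<lparr>machines := m\<rparr>) \<sigma>"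
    by (simp add: tight_instance_def)
  show "real (deadline ?I) < makespan ?I \<sigma>"
  proof (rule ccontr)
    assume "\<not> ?thesis"
    then have "completion \<sigma> j \<le> 1" if "j \<in> {1..m + 2}" for j
    proof -
      have "completion \<sigma> j \<le> Max (completion \<sigma> ` {1..m + 2})"
        using that by (intro Max_ge) simp_all
      with \<open>\<not> real (deadline ?I) < makespan ?I \<sigma>\<close> show ?thesis
        unfolding makespan_def tight_instance_simps by simp
    qed
    \<comment> \<open>A makespan of at most 1 would put a light and a heavy job on time
      together.\<close>
    then have "1 \<in> on_time ?I \<sigma>" "m + 1 \<in> on_time ?I \<sigma>"
      by (auto simp: on_time_def tight_instance_simps)
    then show False
      using tight_instance_on_time_cases[OF feas] \<open>m \<ge> 1\<close> by auto
  qed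
next
  show "conflicts (tight_instance m \<delta>) \<subseteq>
    {{i, j} | i j. i \<in> jobs (tight_instance m \<delta>) \<and> j \<in> jobs (tight_instance m \<delta>) \<and> i \<noteq> j}"
  proof
    fix e assume "e \<in> conflicts (tight_instance m \<delta>)"
    then obtain i j where e: "e = {i, j}" "i \<in> {1..m}" "j \<in> {m + 1, m + 2}"
      unfolding tight_instance_simps by blast
    then have "i \<in> {1..m + 2}" "j \<in> {1..m + 2}" "i \<noteq> j" by auto
    with e(1) show "e \<in> {{i, j} | i j.
        i \<in> jobs (tight_instance m \<delta>) \<and> j \<in> jobs (tight_instance m \<delta>) \<and> i \<noteq> j}"
      unfolding tight_instance_simps by blast
  qed
qed (use assms in \<open>simp_all add: tight_instance_def jobs_def\<close>)

lemma tight_instance_heavy_weight: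
  assumes "on_time (tight_instance m \<delta>) \<sigma> = {m + 1, m + 2}"
  shows "on_time_weight (tight_instance m \<delta>) \<sigma> = 2 + 2 * \<delta>"
  using assms by (simp add: on_time_weight_def tight_instance_simps)

lemma tight_instance_light_weight:
  assumes "on_time (tight_instance m \<delta>) \<sigma> \<subseteq> {1..m}"
  shows "on_time_weight (tight_instance m \<delta>) \<sigma> = card (on_time (tight_instance m \<delta>) \<sigma>)"
proof -
  have "on_time_weight (tight_instance m \<delta>) \<sigma> = (\<Sum>j\<in>on_time (tight_instance m \<delta>) \<sigma>. 1)"
    unfolding on_time_weight_def
    by (rule sum.cong) (use assms in \<open>auto simp: tight_instance_simps\<close>)
  then show ?thesis by simp
qed

lemma tight_instance_optimal:
  assumes "m > 2" "0 < \<delta>" "\<delta> \<le> 1 / 2"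
  obtains \<sigma> where "optimal (tight_instance m \<delta>) \<sigma>" "on_time_weight (tight_instance m \<delta>) \<sigma> = m"
proof -
  let ?I = "tight_instance m \<delta>"
  have I: "?I\<lparr>machines := m\<rparr> = ?I"
    by (simp add: tight_instance_def)
  obtain \<sigma> where \<sigma>: "feasible ?I \<sigma>" "on_time ?I \<sigma> = {1..m}"
    using tight_instance_feasible[of "{1..m}" m m \<delta>] assms(1) by (auto simp: I)
  then have weight: "on_time_weight ?I \<sigma> = m"
    by (simp add: tight_instance_light_weight)
  have "on_time_weight ?I \<tau> \<le> m" if "feasible ?I \<tau>" for \<tau>
  proof -
    have feas: "feasible (?I\<lparr>machines := m\<rparr>) \<tau>" using that I by simp
    consider "on_time ?I \<tau> \<subseteq> {1..m}" | "on_time ?I \<tau> \<subseteq> {m + 1, m + 2}"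
      using tight_instance_on_time_cases[OF feas] by blast
    then show ?thesis
    proof cases
      case 1
      then show ?thesis
        using tight_instance_card_on_time[OF feas] by (simp add: tight_instance_light_weight)
    next
      case 2
      then have "on_time_weight ?I \<tau> \<le> (\<Sum>j\<in>{m + 1, m + 2}. weight ?I j)"
        unfolding on_time_weight_def
        by (intro sum_mono2) (use assms in \<open>auto simp: tight_instance_simps\<close>)
      \<comment> \<open>The heavy pair weighs \<open>2 + 2 * \<delta>\<close>, at most 3 since
        \<open>\<delta>\<close> is at most \<open>1 / 2\<close>, and \<open>m\<close> is at least
        3.\<close>
      also have "\<dots> \<le> m"
        using assms by (simp add: tight_instance_simps)
      finally show ?thesis .
    qed
  qed
  then have "optimal ?I \<sigma>"
    using \<sigma>(1) weight unfolding optimal_def is_arg_max_linorder by auto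
  with weight show thesis using that by blast
qed

text \<open>Two light jobs weigh only 2, less than the attainable \<open>2 + 2 * \<delta>\<close>,
  and reaching that value takes both heavy jobs. The on-time set is thus the same for every choice
  of optimal two-machine schedule.\<close>

lemma tight_instance_two_machines:
  assumes "m > 2" "0 < \<delta>" and opt: "optimal ((tight_instance m \<delta>)\<lparr>machines := 2\<rparr>) \<sigma>"
  shows "on_time (tight_instance m \<delta>) \<sigma> = {m + 1, m + 2}"
proof -
  let ?I = "tight_instance m \<delta>"
  have feas: "feasible (?I\<lparr>machines := 2\<rparr>) \<sigma>"
    using opt by (simp add: optimal_def is_arg_max_linorder)
  obtain \<tau> where \<tau>: "feasible (?I\<lparr>machines := 2\<rparr>) \<tau>" "on_time ?I \<tau> = {m + 1, m + 2}"
    using tight_instance_feasible[of "{m + 1, m + 2}" m 2 \<delta>] by auto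
  have ge: "2 + 2 * \<delta> \<le> on_time_weight ?I \<sigma>"
    using opt \<tau> tight_instance_heavy_weight[OF \<tau>(2)]
    unfolding optimal_def is_arg_max_linorder on_time_weight_machines by metis
  then have "\<not> on_time ?I \<sigma> \<subseteq> {1..m}"
    using tight_instance_card_on_time[OF feas] tight_instance_light_weight[of m \<delta> \<sigma>] assms(2)
    by auto
  then have sub: "on_time ?I \<sigma> \<subseteq> {m + 1, m + 2}"
    using tight_instance_on_time_cases[OF feas] by blast
  then have "on_time_weight ?I \<sigma> = (\<Sum>j\<in>on_time ?I \<sigma>. 1 + \<delta>)"
    unfolding on_time_weight_def by (intro sum.cong) (auto simp: tight_instance_simps)
  then have "2 * (1 + \<delta>) \<le> real (card (on_time ?I \<sigma>)) * (1 + \<delta>)"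
    using ge by simp
  then have "2 \<le> card (on_time ?I \<sigma>)"
    using assms(2) by (subst (asm) mult_le_cancel_right_pos) auto
  with sub show ?thesis
    by (intro card_seteq) simp_all
qed

lemma tightness:
  assumes "m > 2" and A: "A \<in> two_machine_class m" and "\<epsilon> > 0"
  shows "\<exists>I \<sigma>. valid_instance I \<and> machines I = m \<and> optimal I \<sigma> \<and>
    on_time_weight I \<sigma> > (real m / 2 - \<epsilon>) * on_time_weight I (A I)"
proof -
  \<comment> \<open>The bound \<open>1 / 2\<close> keeps the light jobs optimal on \<open>m\<close>
    machines; the bound \<open>\<epsilon> / real m\<close> makes the excess
    \<open>m * \<delta>\<close> at most \<open>\<epsilon>\<close>.\<close>
  define \<delta> where "\<delta> = min (1 / 2) (\<epsilon> / real m)"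
  let ?I = "tight_instance m \<delta>"
  have \<delta>: "0 < \<delta>" "\<delta> \<le> 1 / 2" "real m * \<delta> \<le> \<epsilon>"
    using assms unfolding \<delta>_def by (auto simp: min_def field_simps)
  have valid: "valid_instance ?I" and machines: "machines ?I = m"
    using tight_instance_valid \<delta>(1) assms(1) by (auto simp: tight_instance_simps)
  obtain \<sigma> where \<sigma>: "optimal ?I \<sigma>" "on_time_weight ?I \<sigma> = m"
    using tight_instance_optimal assms(1) \<delta> by blast
  obtain \<sigma>2 where "optimal (?I\<lparr>machines := 2\<rparr>) \<sigma>2" "on_time ?I \<sigma>2 \<subseteq> on_time ?I (A ?I)"
    using A valid machines unfolding two_machine_class_def by blast
  then have heavy: "{m + 1, m + 2} \<subseteq> on_time ?I (A ?I)"
    using tight_instance_two_machines assms(1) \<delta>(1) by metis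
  have "feasible (?I\<lparr>machines := m\<rparr>) (A ?I)"
    using A valid machines unfolding two_machine_class_def is_algorithm_def
    by (simp add: tight_instance_def)
  \<comment> \<open>Once the heavy pair is on time, every light job is excluded, however many
    machines remain idle.\<close>
  from tight_instance_on_time_cases[OF this] heavy
  have "on_time ?I (A ?I) = {m + 1, m + 2}"
    by auto
  then have "(real m / 2 - \<epsilon>) * on_time_weight ?I (A ?I) = (real m / 2 - \<epsilon>) * (2 + 2 * \<delta>)"
    by (simp only: tight_instance_heavy_weight)
  \<comment> \<open>Grouped so that the bracket is at most 0 and the remaining terms are strictly
    negative.\<close>
  also have "\<dots> = m + (m * \<delta> - \<epsilon>) - \<epsilon> - 2 * (\<epsilon> * \<delta>)"
    by (simp add: algebra_simps)
  also have "\<dots> < m"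
    using \<delta> \<open>\<epsilon> > 0\<close> mult_pos_pos[of \<epsilon> \<delta>] by linarith
  finally show ?thesis
    using valid machines \<sigma> by (intro exI[of _ ?I] exI[of _ \<sigma>]) simp
qed

theorem theorem1:
  fixes m :: nat
  assumes "m > 2"
  shows "\<forall>A \<in> two_machine_class m.
    (\<forall>I \<sigma>opt. valid_instance I \<and> machines I = m \<and> optimal I \<sigma>opt \<longrightarrow>
       on_time_weight I \<sigma>opt \<le> real m / 2 * on_time_weight I (A I)) \<and>
    (\<forall>\<epsilon>::real. \<epsilon> > 0 \<longrightarrow>
       (\<exists>I \<sigma>opt. valid_instance I \<and> machines I = m \<and> optimal I \<sigma>opt \<and>
          on_time_weight I \<sigma>opt > (real m / 2 - \<epsilon>) * on_time_weight I (A I)))"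
proof (intro ballI conjI allI impI; (elim conjE)?)
  fix A I \<sigma>opt
  assume "A \<in> two_machine_class m" "valid_instance I" "machines I = m" "optimal I \<sigma>opt"
  then show "on_time_weight I \<sigma>opt \<le> real m / 2 * on_time_weight I (A I)"
    using guarantee assms by (simp add: optimal_def is_arg_max_linorder)
qed (use tightness assms in blast)

end
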